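(* Let $n\ge2$, let $q$ be a prime power and $\mathbb{V}_0=\mathbb{F}_q^n$. For the graph $\mathbf{SIG}(\mathbb{V}_0)$ the following statements hold: (1) $\gamma_{\mathcal{E}^{n-1}(\mathbb{F}_q)}(\mathbf{SIG}(\mathbb{V}_0))=|\mathbb{P}^{n-1}(\mathbb{F}_q)|=\frac{q^n-1}{q-1}$. (2) $\gamma_{\mathbb{P}^{n-1}(\mathbb{F}_q)}(\mathbf{SIG}(\mathbb{V}_0))=1$. (3) $\gamma(\mathbf{SIG}(\mathbb{V}_0))=\frac{q^n-1}{q-1}$.
   Context: $\mathbb{F}_q$ is the finite field with $q$ elements and $\mathbb{V}_0=\mathbb{F}_q^n$ is the space of column vectors. $E_n(\mathbb{F}_q)$ is the set of nonzero matrices $M\in M_n(\mathbb{F}_q)$ having at least one eigenvector in $\mathbb{V}_0$ (a nonzero $v$ with $Mv=\lambda v$ for some $\lambda\in\mathbb{F}_q$; $\lambda=0$ allowed). $\mathcal{E}^{n-1}(\mathbb{F}_q)=\{\langle M\rangle: M\in E_n(\mathbb{F}_q)\}$ is the set of one-dimensional subspaces of $M_n(\mathbb{F}_q)$ generated by elements of $E_n(\mathbb{F}_q)$, and $\mathbb{P}^{n-1}(\mathbb{F}_q)$ is the set of one-dimensional subspaces $\langle v\rangle$ of $\mathbb{V}_0$. The spectral incidence graph $\mathbf{SIG}(\mathbb{V}_0)$ is the simple bipartite graph with vertex set the disjoint union $\mathcal{E}^{n-1}(\mathbb{F}_q)\cup\mathbb{P}^{n-1}(\mathbb{F}_q)$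 in which $\langle M\rangle$ and $\langle v\rangle$ are adjacent iff $v$ is an eigenvector of $M$. A dominating set of a graph with vertex set $V$ is a subset $D\subseteq V$ such that every vertex of $V\setminus D$ is adjacent to at least one vertex of $D$; $\gamma$ is the minimum cardinality of a dominating set. For a bipartite graph with parts $A,B$, a subset $D\subseteq B$ dominates $A$ if every vertex of $A$ is adjacent to at least one vertex of $D$, and $\gamma_A$ is the minimum cardinality of a subset $D\subseteq B$ dominating $A$ (likewise $\gamma_B$ with the roles exchanged). *)

theory Defs
  imports
    "HOL-Number_Theory.Prime_Powers"
    "Jordan_Normal_Form.Char_Poly"
    "Jordan_Normal_Form.VS_Connect"
    "Graph_Theory.Pair_Digraph"
begin

section \<open>Domination in graphs\<close>

text \<open>
  As in \<^theory>\<open>Graph_Theory.Digraph\<close>, a simple undirected graph is a finite symmetric digraph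
  without loops (\<^locale>\<open>pair_graph\<close>).

  The minima below range over finite sets only, because \<^const>\<open>card\<close> is 0 on infinite sets.
\<close>

definition dominating_set :: "'v pair_pre_digraph \<Rightarrow> 'v set \<Rightarrow> bool" where
  "dominating_set G D \<longleftrightarrow>
     D \<subseteq> pverts G \<and> (\<forall>v \<in> pverts G - D. \<exists>d \<in> D. (v, d) \<in> parcs G)"

definition domination_number :: "'v pair_pre_digraph \<Rightarrow> nat" where
  "domination_number G = (LEAST k. \<exists>D. finite D \<and> dominating_set G D \<and> card D = k)"

definition bipartite :: "'v pair_pre_digraph \<Rightarrow> 'v set \<Rightarrow> 'v set \<Rightarrow> bool" where
  "bipartite G A B \<longleftrightarrow>
     A \<union> B = pverts G \<and> A \<inter> B = {} \<and> parcs G \<subseteq> A \<times> B \<union> B \<times> A"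

definition dominates_part :: "'v pair_pre_digraph \<Rightarrow> 'v set \<Rightarrow> 'v set \<Rightarrow> bool" where
  "dominates_part G A D \<longleftrightarrow> (\<forall>a \<in> A. \<exists>d \<in> D. (a, d) \<in> parcs G)"

text \<open>The number $\gamma_A(G)$ of a graph with bipartition $A, B$.\<close>

definition part_domination_number :: "'v pair_pre_digraph \<Rightarrow> 'v set \<Rightarrow> 'v set \<Rightarrow> nat" where
  "part_domination_number G A B =
     (LEAST k. \<exists>D. finite D \<and> D \<subseteq> B \<and> dominates_part G A D \<and> card D = k)"


section \<open>The spectral incidence graph\<close>

definition vec_line :: "'a::field vec \<Rightarrow> 'a vec set" where
  "vec_line v = LinearCombinations.module.span class_ring (module_vec TYPE('a) (dim_vec v)) {v}"

definition mat_line :: "'a::field mat \<Rightarrow> 'a mat set" where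
  "mat_line M =
     LinearCombinations.module.span class_ring (module_mat TYPE('a) (dim_row M) (dim_col M)) {M}"

definition points :: "'a::field itself \<Rightarrow> nat \<Rightarrow> 'a vec set set" where
  "points T n = {vec_line v | v. v \<in> carrier_vec n \<and> v \<noteq> 0\<^sub>v n}"

definition eig_mats :: "'a::field itself \<Rightarrow> nat \<Rightarrow> 'a mat set" where
  "eig_mats T n = {M \<in> carrier_mat n n. M \<noteq> 0\<^sub>m n n \<and> (\<exists>v k. eigenvector M v k)}"

definition eig_lines :: "'a::field itself \<Rightarrow> nat \<Rightarrow> 'a mat set set" where
  "eig_lines T n = {mat_line M | M. M \<in> eig_mats T n}"

definition SIG_mat_part :: "'a::field itself \<Rightarrow> nat \<Rightarrow> ('a mat set + 'a vec set) set" where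
  "SIG_mat_part T n = Inl ` eig_lines T n"

definition SIG_point_part :: "'a::field itself \<Rightarrow> nat \<Rightarrow> ('a mat set + 'a vec set) set" where
  "SIG_point_part T n = Inr ` points T n"

definition SIG_edges :: "'a::field itself \<Rightarrow> nat \<Rightarrow> ('a mat set + 'a vec set) rel" where
  "SIG_edges T n =
     {(Inl (mat_line M), Inr (vec_line v)) | M v. M \<in> eig_mats T n \<and> (\<exists>k. eigenvector M v k)}"

definition SIG :: "'a::field itself \<Rightarrow> nat \<Rightarrow> ('a mat set + 'a vec set) pair_pre_digraph" where
  "SIG T n = \<lparr> pverts = SIG_mat_part T n \<union> SIG_point_part T n,
               parcs = SIG_edges T n \<union> (SIG_edges T n)\<inverse> \<rparr>"


section \<open>Well-definedness\<close>

lemma vec_line_eq: "vec_line v = range (\<lambda>c. c \<cdot>\<^sub>v v)" for v :: "'a::field vec"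
proof -
  interpret vectorspace class_ring "module_vec TYPE('a) (dim_vec v)" by (rule vec_vs)
  have "span {v} = {lincomb a {v} | a. a \<in> {v} \<rightarrow> carrier class_ring}"
    by (rule finite_span) (auto simp: module_vec_simps)
  also have "\<dots> = range (\<lambda>c. c \<cdot>\<^sub>v v)"
  proof -
    have lc: "lincomb a {v} = a v \<cdot>\<^sub>v v" for a
      by (simp add: lincomb_def module_vec_simps)
    have "range (\<lambda>c. c \<cdot>\<^sub>v v) \<subseteq> {lincomb a {v} | a. a \<in> {v} \<rightarrow> carrier class_ring}"
    proof
      fix x assume "x \<in> range (\<lambda>c. c \<cdot>\<^sub>v v)"
      then obtain c where "x = lincomb (\<lambda>_. c) {v}" by (auto simp: lc)
      then show "x \<in> {lincomb a {v} | a. a \<in> {v} \<rightarrow> carrier class_ring}"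
        by (auto simp: class_ring_simps)
    qed
    then show ?thesis by (auto simp: lc)
  qed
  finally show ?thesis by (simp add: vec_line_def)
qed

lemma mat_line_eq: "mat_line M = range (\<lambda>c. c \<cdot>\<^sub>m M)" for M :: "'a::field mat"
proof -
  interpret vectorspace class_ring "module_mat TYPE('a) (dim_row M) (dim_col M)"
    by (rule matrix_vs)
  have "span {M} = {lincomb a {M} | a. a \<in> {M} \<rightarrow> carrier class_ring}"
    by (rule finite_span) (auto simp: module_mat_simps)
  also have "\<dots> = range (\<lambda>c. c \<cdot>\<^sub>m M)"
  proof -
    have lc: "lincomb a {M} = a M \<cdot>\<^sub>m M" for a
      by (simp add: lincomb_def module_mat_simps)
    have "range (\<lambda>c. c \<cdot>\<^sub>m M) \<subseteq> {lincomb a {M} | a. a \<in> {M} \<rightarrow> carrier class_ring}"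
    proof
      fix x assume "x \<in> range (\<lambda>c. c \<cdot>\<^sub>m M)"
      then obtain c where "x = lincomb (\<lambda>_. c) {M}" by (auto simp: lc)
      then show "x \<in> {lincomb a {M} | a. a \<in> {M} \<rightarrow> carrier class_ring}"
        by (auto simp: class_ring_simps)
    qed
    then show ?thesis by (auto simp: lc)
  qed
  finally show ?thesis by (simp add: mat_line_def)
qed

text \<open>Adjacency does not depend on the chosen generators.\<close>

lemma SIG_adjacent_iff:
  fixes M :: "'a::field mat"
  assumes M: "M \<in> eig_mats TYPE('a) n" and v: "v \<in> carrier_vec n" "v \<noteq> 0\<^sub>v n"
  shows "(Inl (mat_line M), Inr (vec_line v)) \<in> parcs (SIG TYPE('a) n)
           \<longleftrightarrow> (\<exists>k. eigenvector M v k)" (is "?L \<longleftrightarrow> ?R")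
proof
  assume ?R
  then show ?L using M by (auto simp: SIG_def SIG_edges_def)
next
  assume ?L
  then obtain N w k where N: "N \<in> eig_mats TYPE('a) n" and w: "eigenvector N w k"
    and eq: "mat_line M = mat_line N" "vec_line v = vec_line w"
    by (auto simp: SIG_def SIG_edges_def)
  have "1 \<cdot>\<^sub>m M \<in> mat_line M" "1 \<cdot>\<^sub>v v \<in> vec_line v"
    unfolding mat_line_eq vec_line_eq by blast+
  moreover have "1 \<cdot>\<^sub>m M = M" by (intro eq_matI) auto
  ultimately obtain c d where c: "M = c \<cdot>\<^sub>m N" and d: "v = d \<cdot>\<^sub>v w"
    unfolding eq unfolding mat_line_eq vec_line_eq by auto
  have dims: "N \<in> carrier_mat n n" "w \<in> carrier_vec n" "N *\<^sub>v w = k \<cdot>\<^sub>v w"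
    using N w by (auto simp: eig_mats_def eigenvector_def)
  have "M *\<^sub>v v = d \<cdot>\<^sub>v (M *\<^sub>v w)"
    unfolding d using dims c by (intro mult_mat_vec) auto
  also have "M *\<^sub>v w = c \<cdot>\<^sub>v (N *\<^sub>v w)"
    unfolding c using dims(1,2) by (intro eq_vecI) (auto simp: scalar_prod_def sum_distrib_left mult_ac)
  finally have "M *\<^sub>v v = (c * k) \<cdot>\<^sub>v v"
    unfolding d dims(3) by (simp add: smult_smult_assoc mult_ac)
  then show ?R using M v by (auto simp: eigenvector_def eig_mats_def)
qed

lemma SIG_bipartite:
  "bipartite (SIG TYPE('a::field) n) (SIG_mat_part TYPE('a) n) (SIG_point_part TYPE('a) n)"
proof -
  have "vec_line v \<in> points TYPE('a) n" if "M \<in> eig_mats TYPE('a) n" "eigenvector M v k" for M v k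
    using that by (auto simp: points_def eig_mats_def eigenvector_def)
  then have "SIG_edges TYPE('a) n \<subseteq> SIG_mat_part TYPE('a) n \<times> SIG_point_part TYPE('a) n"
    by (auto simp: SIG_edges_def SIG_mat_part_def SIG_point_part_def eig_lines_def)
  then show ?thesis
    by (auto simp: bipartite_def SIG_def SIG_mat_part_def SIG_point_part_def)
qed

lemma SIG_pair_graph: "pair_graph (SIG TYPE('a::{field,finite}) n)"
proof -
  let ?G = "SIG TYPE('a) n"
  have bip: "parcs ?G \<subseteq> SIG_mat_part TYPE('a) n \<times> SIG_point_part TYPE('a) n
      \<union> SIG_point_part TYPE('a) n \<times> SIG_mat_part TYPE('a) n"
    and verts: "pverts ?G = SIG_mat_part TYPE('a) n \<union> SIG_point_part TYPE('a) n"
    using SIG_bipartite[where 'a='a and n=n] by (auto simp: bipartite_def)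
  have "carrier_mat n n \<subseteq> (\<lambda>f. mat n n f) ` (({..<n} \<times> {..<n}) \<rightarrow>\<^sub>E (UNIV :: 'a set))"
  proof
    fix M :: "'a mat" assume "M \<in> carrier_mat n n"
    then have "M = mat n n (restrict (\<lambda>ij. M $$ ij) ({..<n} \<times> {..<n}))"
      by (intro eq_matI) auto
    then show "M \<in> (\<lambda>f. mat n n f) ` (({..<n} \<times> {..<n}) \<rightarrow>\<^sub>E UNIV)"
      by (intro image_eqI) (auto split: if_splits)
  qed
  then have "finite (carrier_mat n n :: 'a mat set)"
    by (rule finite_subset) (intro finite_imageI finite_PiE, auto)
  then have "finite (eig_lines TYPE('a) n)"
    by (auto simp: eig_lines_def eig_mats_def)
  moreover have "carrier_vec n \<subseteq> (\<lambda>f. vec n f) ` ({..<n} \<rightarrow>\<^sub>E (UNIV :: 'a set))"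
  proof
    fix v :: "'a vec" assume "v \<in> carrier_vec n"
    then have "v = vec n (restrict (\<lambda>i. v $ i) {..<n})"
      by (intro eq_vecI) auto
    then show "v \<in> (\<lambda>f. vec n f) ` ({..<n} \<rightarrow>\<^sub>E UNIV)"
      by (intro image_eqI) (auto split: if_splits)
  qed
  then have "finite (carrier_vec n :: 'a vec set)"
    by (rule finite_subset) (intro finite_imageI finite_PiE, auto)
  then have "finite (points TYPE('a) n)"
    by (auto simp: points_def)
  ultimately have fin: "finite (pverts ?G)"
    by (simp add: verts SIG_mat_part_def SIG_point_part_def)
  have sub: "parcs ?G \<subseteq> pverts ?G \<times> pverts ?G"
    using bip verts by blast
  show ?thesis
  proof
    show "fst e \<in> pverts ?G" "snd e \<in> pverts ?G" if "e \<in> parcs ?G" for e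
      using that sub by auto
    show "finite (pverts ?G)" by (rule fin)
    show "finite (parcs ?G)" by (rule finite_subset[OF sub]) (use fin in simp)
    show "fst e \<noteq> snd e" if "e \<in> parcs ?G" for e
      using that by (auto simp: SIG_def SIG_edges_def)
    show "symmetric (with_proj ?G)"
      by (auto simp: symmetric_def SIG_def intro: symI)
  qed
qed

end

theory Submission
  imports
    Defs
    "Jordan_Normal_Form.Schur_Decomposition"
    "Jordan_Normal_Form.DL_Rank"
    "Jordan_Normal_Form.Jordan_Normal_Form"
    "Berlekamp_Zassenhaus.Berlekamp_Type_Based"
begin

text \<open>
  Every point \<open>\<langle>v\<rangle>\<close> of the projective space has a private neighbour in the spectral incidence graph:
  a matrix line \<open>\<langle>M\<rangle>\<close> of degree one, whose only neighbour is \<open>\<langle>v\<rangle>\<close>. One takes the nilpotent Jordan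
  block of size \<open>n\<close>, whose eigenvectors are exactly the nonzero multiples of the first unit vector,
  and conjugates it by an invertible matrix with first column \<open>v\<close>
  (\<open>exists_mat_with_single_eigenline\<close>). The condition \<open>n \<ge> 2\<close> makes this matrix nonzero, so that it
  does span a vertex of the graph.

  The rest is graph theory. A set of points that dominates all matrix lines must contain every
  point, since a vertex of degree one can be dominated from the other part only by its neighbour.
  An arbitrary dominating set contains, for every point, that point or its private neighbour; these pairs
  are disjoint, so the set has at least as many elements as there are points. Conversely the set of
  all points is dominating, because every matrix in question has an eigenvector. Both domination
  numbers therefore equal the number of points. In the other direction a single vertex
  dominates all points: the line of the identity matrix.

  The number of points comes from the partition of the \<open>q ^ n - 1\<close> nonzero vectors into
  punctured lines, each with \<open>q - 1\<close> elements.
\<close>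

section \<open>Domination in bipartite graphs with pendant vertices\<close>

lemma part_domination_number_eqI:
  assumes "finite D" "D \<subseteq> B" "dominates_part G A D"
    and "\<And>D'. finite D' \<Longrightarrow> D' \<subseteq> B \<Longrightarrow> dominates_part G A D' \<Longrightarrow> card D \<le> card D'"
  shows "part_domination_number G A B = card D"
  unfolding part_domination_number_def using assms by (intro Least_equality) auto

lemma domination_number_eqI:
  assumes "finite D" "dominating_set G D"
    and "\<And>D'. finite D' \<Longrightarrow> dominating_set G D' \<Longrightarrow> card D \<le> card D'"
  shows "domination_number G = card D"
  unfolding domination_number_def using assms by (intro Least_equality) auto

lemma part_domination_number_eq_1I:
  assumes "b \<in> B" and "A \<noteq> {}" and "\<And>a. a \<in> A \<Longrightarrow> (a, b) \<in> parcs G"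
  shows "part_domination_number G A B = 1"
proof -
  have "part_domination_number G A B = card {b}"
  proof (rule part_domination_number_eqI)
    show "dominates_part G A {b}"
      using assms by (auto simp: dominates_part_def)
    show "card {b} \<le> card D" if "finite D" "dominates_part G A D" for D
    proof -
      have "D \<noteq> {}" using that \<open>A \<noteq> {}\<close> by (auto simp: dominates_part_def)
      with \<open>finite D\<close> show ?thesis by (simp add: Suc_le_eq card_gt_0_iff)
    qed
  qed (use assms in auto)
  then show ?thesis by simp
qed

text \<open>
  The next two lemmas assume that every vertex of \<open>B\<close> has a neighbour of degree one in \<open>A\<close>. Such a
  neighbour can be dominated from \<open>B\<close> only by its vertex, which forces \<open>B\<close> to be used in full.
\<close>

lemma part_domination_number_if_pendant:
  assumes bip: "bipartite G A B" and "finite B"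
    and cover: "\<And>a. a \<in> A \<Longrightarrow> \<exists>b. (a, b) \<in> parcs G"
    and pendant: "\<And>b. b \<in> B \<Longrightarrow> \<exists>a \<in> A. \<forall>x. (a, x) \<in> parcs G \<longleftrightarrow> x = b"
  shows "part_domination_number G A B = card B"
proof (rule part_domination_number_eqI)
  show "dominates_part G A B"
    using bip cover by (fastforce simp: dominates_part_def bipartite_def)
  show "card B \<le> card D" if "finite D" "D \<subseteq> B" "dominates_part G A D" for D
  proof -
    have "B \<subseteq> D"
    proof
      fix b assume "b \<in> B"
      then obtain a where a: "a \<in> A" "\<And>x. (a, x) \<in> parcs G \<longleftrightarrow> x = b"
        using pendant by blast
      then show "b \<in> D" using that(3) by (auto simp: dominates_part_def)
    qed
    with \<open>finite D\<close> show ?thesis by (rule card_mono)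
  qed
qed (use assms in auto)

text \<open>
  A general dominating set may replace a vertex of \<open>B\<close> by its pendant neighbour, so the lower
  bound comes from an injection of \<open>B\<close> into the dominating set that makes this replacement.
\<close>

lemma domination_number_if_pendant:
  assumes bip: "bipartite G A B" and "finite B"
    and cover: "\<And>a. a \<in> A \<Longrightarrow> \<exists>b. (a, b) \<in> parcs G"
    and pendant: "\<And>b. b \<in> B \<Longrightarrow> \<exists>a \<in> A. \<forall>x. (a, x) \<in> parcs G \<longleftrightarrow> x = b"
  shows "domination_number G = card B"
proof (rule domination_number_eqI)
  show "dominating_set G B"
    using bip cover by (fastforce simp: dominating_set_def bipartite_def)
  show "card B \<le> card D" if "finite D" "dominating_set G D" for D
  proof -
    obtain l where l: "\<And>b. b \<in> B \<Longrightarrow> l b \<in> A"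
        "\<And>b x. b \<in> B \<Longrightarrow> (l b, x) \<in> parcs G \<longleftrightarrow> x = b"
      using pendant by metis
    define f where "f b = (if b \<in> D then b else l b)" for b
    have "inj_on l B" by (rule inj_onI) (metis l(2))
    moreover have "l b \<notin> B" if "b \<in> B" for b
      using l(1)[OF that] bip by (auto simp: bipartite_def)
    ultimately have "inj_on f B"
      by (auto simp: inj_on_def f_def)
    moreover have "f ` B \<subseteq> D"
    proof
      fix y assume "y \<in> f ` B"
      then obtain b where b: "b \<in> B" "y = f b" by auto
      have "l b \<in> pverts G" using l(1)[OF b(1)] bip by (auto simp: bipartite_def)
      then have "l b \<in> D \<or> (\<exists>d \<in> D. (l b, d) \<in> parcs G)"
        using \<open>dominating_set G D\<close> by (auto simp: dominating_set_def)
      then have "l b \<in> D \<or> b \<in> D" using l(2)[OF b(1)] by auto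
      then show "y \<in> D" using b by (auto simp: f_def)
    qed
    ultimately show ?thesis using \<open>finite D\<close> by (rule card_inj_on_le)
  qed
qed (rule \<open>finite B\<close>)


section \<open>A matrix with a prescribed single eigenline\<close>

text \<open>
  The nilpotent block shifts coordinates, so for an eigenvector each coordinate is the eigenvalue
  times the preceding one, and the last coordinate is annihilated by the eigenvalue. A nonzero
  eigenvalue would thus kill all coordinates, starting from the last; the eigenvalue 0 kills all but
  the first.
\<close>

lemma eigenvector_jordan_block_0:
  fixes u :: "'a::field vec"
  assumes "eigenvector (jordan_block n 0) u k"
  shows "\<exists>c. u = c \<cdot>\<^sub>v unit_vec n 0"
proof -
  have u: "u \<in> carrier_vec n" "u \<noteq> 0\<^sub>v n" and Ju: "jordan_block n 0 *\<^sub>v u = k \<cdot>\<^sub>v u"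
    using assms by (auto simp: eigenvector_def)
  have shift: "k * u $ i = (if Suc i < n then u $ Suc i else 0)" if "i < n" for i
  proof -
    have "k * u $ i = (jordan_block n 0 *\<^sub>v u) $ i" using that u Ju by simp
    also have "\<dots> = (\<Sum>j = 0..<n. jordan_block n 0 $$ (i, j) * u $ j)"
      using that u by (simp add: scalar_prod_def)
    also have "\<dots> = (\<Sum>j = 0..<n. if j = Suc i then u $ j else 0)"
      using that by (intro sum.cong) auto
    finally show ?thesis by (simp add: sum.delta)
  qed
  have "k = 0"
  proof (rule ccontr)
    assume "k \<noteq> 0"
    have "u $ i = 0" if "i < n" for i
      using that
    proof (induction "n - i" arbitrary: i rule: less_induct)
      case less
      then have "k * u $ i = 0" using shift[of i] by auto
      with \<open>k \<noteq> 0\<close> show ?case by simp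
    qed
    then have "u = 0\<^sub>v n" using u by (intro eq_vecI) auto
    with u show False by simp
  qed
  then have "u $ Suc i = 0" if "Suc i < n" for i
    using shift[of i] that by auto
  then have "u = u $ 0 \<cdot>\<^sub>v unit_vec n 0"
    using u by (intro eq_vecI) (auto simp: unit_vec_def gr0_conv_Suc)
  then show ?thesis by blast
qed

text \<open>The columns of \<open>P\<close> are a basis that extends \<open>v\<close>; full rank makes \<open>P\<close> invertible.\<close>

lemma exists_invertible_with_first_col:
  fixes v :: "'a::field vec"
  assumes v: "v \<in> carrier_vec n" "v \<noteq> 0\<^sub>v n"
  obtains P Q where "P \<in> carrier_mat n n" "Q \<in> carrier_mat n n"
    "P * Q = 1\<^sub>m n" "Q * P = 1\<^sub>m n" "P *\<^sub>v unit_vec n 0 = v"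
proof -
  interpret vec_space "TYPE('a)" n .
  define b where "b = basis_completion v"
  note b = basis_completion[OF v, folded b_def]
  define P where "P = mat_of_cols n b"
  have P: "P \<in> carrier_mat n n" using b(6) by (simp add: P_def carrier_matI)
  have "cols P = b" unfolding P_def using b(2) by (rule cols_mat_of_cols)
  then have "rank P = n" using b(4,5) by (intro lin_indpt_full_rank[OF P]) auto
  then have "det P \<noteq> 0" using det_zero_low_rank[OF P] by auto
  then have "P \<in> Units (ring_mat TYPE('a) n ())" by (rule det_non_zero_imp_unit[OF P])
  then obtain Q where Q: "Q \<in> carrier_mat n n" "P * Q = 1\<^sub>m n" "Q * P = 1\<^sub>m n"
    by (auto simp: Units_def ring_mat_simps)
  have "n > 0" using v by (cases n) (auto intro: eq_vecI)
  then have "b ! 0 = v" using b(6,7) by (cases b) auto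
  have "P *\<^sub>v unit_vec n 0 = v"
  proof (rule eq_vecI)
    fix i assume "i < dim_vec v"
    then have i: "i < n" using v by simp
    then have "(P *\<^sub>v unit_vec n 0) $ i = row P i $ 0"
      using P \<open>n > 0\<close> by simp
    also have "\<dots> = v $ i"
      using P i \<open>n > 0\<close> \<open>b ! 0 = v\<close> b(6) by (simp add: P_def mat_of_cols_index)
    finally show "(P *\<^sub>v unit_vec n 0) $ i = v $ i" .
  qed (use P v in auto)
  then show thesis using that P Q by blast
qed

text \<open>
  Conjugation carries the eigenvectors of the nilpotent Jordan block, that is the multiples of the
  first unit vector, to the multiples of \<open>v\<close>.
\<close>

lemma exists_mat_with_single_eigenline:
  fixes v :: "'a::field vec"
  assumes "n \<ge> 2" and v: "v \<in> carrier_vec n" "v \<noteq> 0\<^sub>v n"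
  obtains M where "M \<in> carrier_mat n n" "M \<noteq> 0\<^sub>m n n" "eigenvector M v 0"
    "\<And>w k. eigenvector M w k \<Longrightarrow> \<exists>c. w = c \<cdot>\<^sub>v v"
proof -
  obtain P Q where P: "P \<in> carrier_mat n n" and Q: "Q \<in> carrier_mat n n"
    and PQ: "P * Q = 1\<^sub>m n" and QP: "Q * P = 1\<^sub>m n" and Pv: "P *\<^sub>v unit_vec n 0 = v"
    using exists_invertible_with_first_col[OF v] by blast
  let ?J = "jordan_block n 0 :: 'a mat"
  have J: "?J \<in> carrier_mat n n" by simp
  define M where "M = P * ?J * Q"
  have M: "M \<in> carrier_mat n n" using P Q J by (auto simp: M_def)
  have QM: "Q *\<^sub>v (M *\<^sub>v w) = ?J *\<^sub>v (Q *\<^sub>v w)" if "w \<in> carrier_vec n" for w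
  proof -
    have Qw: "Q *\<^sub>v w \<in> carrier_vec n" and JQw: "?J *\<^sub>v (Q *\<^sub>v w) \<in> carrier_vec n"
      using mult_mat_vec_carrier[OF Q that] mult_mat_vec_carrier[OF J] by auto
    have "M *\<^sub>v w = P *\<^sub>v (?J *\<^sub>v (Q *\<^sub>v w))"
      unfolding M_def using assoc_mult_mat_vec[OF mult_carrier_mat[OF P J] Q that]
        assoc_mult_mat_vec[OF P J Qw] by simp
    then have "Q *\<^sub>v (M *\<^sub>v w) = (Q * P) *\<^sub>v (?J *\<^sub>v (Q *\<^sub>v w))"
      using assoc_mult_mat_vec[OF Q P JQw] by simp
    then show ?thesis using QP JQw by simp
  qed
  have PQw: "P *\<^sub>v (Q *\<^sub>v w) = w" if "w \<in> carrier_vec n" for w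
    using P Q PQ that by (metis assoc_mult_mat_vec one_mult_mat_vec)
  have Qv: "Q *\<^sub>v v = unit_vec n 0"
    using P Q QP by (metis Pv assoc_mult_mat_vec one_mult_mat_vec unit_vec_carrier)
  show thesis
  proof
    show "M \<in> carrier_mat n n" by (rule M)
    show "M \<noteq> 0\<^sub>m n n"
    proof
      assume "M = 0\<^sub>m n n"
      \<comment> \<open>The block maps the second unit vector to the first one, so \<open>M = 0\<close> would make
        the first one zero.\<close>
      define w where "w = P *\<^sub>v unit_vec n 1"
      have w: "w \<in> carrier_vec n"
        unfolding w_def using P by (rule mult_mat_vec_carrier) simp
      have "Q *\<^sub>v w = unit_vec n 1"
        using assoc_mult_mat_vec[OF Q P unit_vec_carrier[of n 1]] QP by (simp add: w_def)
      then have "?J *\<^sub>v unit_vec n 1 = Q *\<^sub>v (M *\<^sub>v w)"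
        using QM[OF w] by simp
      also have "M *\<^sub>v w = 0\<^sub>v n"
        using w by (intro eq_vecI) (auto simp: \<open>M = 0\<^sub>m n n\<close>)
      also have "Q *\<^sub>v 0\<^sub>v n = 0\<^sub>v n" using Q by (intro eq_vecI) auto
      finally have "(?J *\<^sub>v unit_vec n 1) $ 0 = 0" using \<open>n \<ge> 2\<close> by simp
      then show False using \<open>n \<ge> 2\<close> by simp
    qed
    show "\<exists>c. w = c \<cdot>\<^sub>v v" if "eigenvector M w k" for w k
    proof -
      have w: "w \<in> carrier_vec n" "w \<noteq> 0\<^sub>v n" "M *\<^sub>v w = k \<cdot>\<^sub>v w"
        using that carrier_matD(1)[OF M] unfolding eigenvector_def by simp_all
      have Qw: "Q *\<^sub>v w \<in> carrier_vec n" using Q w(1) by (rule mult_mat_vec_carrier)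
      have "Q *\<^sub>v w \<noteq> 0\<^sub>v n" 
      proof
        assume "Q *\<^sub>v w = 0\<^sub>v n"
        then have "w = P *\<^sub>v 0\<^sub>v n" using PQw[OF w(1)] by simp
        then show False using P w(2) by (auto intro!: eq_vecI)
      qed
      moreover have "?J *\<^sub>v (Q *\<^sub>v w) = k \<cdot>\<^sub>v (Q *\<^sub>v w)"
        using QM[OF w(1)] mult_mat_vec[OF Q w(1)] w(3) by simp
      ultimately have "eigenvector ?J (Q *\<^sub>v w) k"
        using Qw by (simp add: eigenvector_def)
      then obtain c where "Q *\<^sub>v w = c \<cdot>\<^sub>v unit_vec n 0"
        using eigenvector_jordan_block_0 by blast
      then have "w = c \<cdot>\<^sub>v v"
        using PQw[OF w(1)] mult_mat_vec[OF P unit_vec_carrier] Pv by simp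
      then show ?thesis ..
    qed
    have "?J *\<^sub>v unit_vec n 0 = 0\<^sub>v n"
      using \<open>n \<ge> 2\<close> by (intro eq_vecI) auto
    then have "Q *\<^sub>v (M *\<^sub>v v) = 0\<^sub>v n"
      using QM[OF v(1)] Qv by simp
    then have "M *\<^sub>v v = P *\<^sub>v 0\<^sub>v n"
      using PQw[OF mult_mat_vec_carrier[OF M v(1)]] by simp
    also have "\<dots> = 0 \<cdot>\<^sub>v v" using P v by (intro eq_vecI) auto
    finally show "eigenvector M v 0"
      using v carrier_matD(1)[OF M] by (simp add: eigenvector_def)
  qed
qed


section \<open>Counting points\<close>

lemma mem_vec_line: "v \<in> vec_line v" for v :: "'a::field vec"
proof -
  have "1 \<cdot>\<^sub>v v \<in> vec_line v" unfolding vec_line_eq by blast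
  then show ?thesis by simp
qed

lemma vec_line_smult:
  fixes v :: "'a::field vec"
  assumes "c \<noteq> 0"
  shows "vec_line (c \<cdot>\<^sub>v v) = vec_line v"
proof -
  have "d \<cdot>\<^sub>v v = (d / c) \<cdot>\<^sub>v (c \<cdot>\<^sub>v v)" for d
    using assms by (simp add: smult_smult_assoc)
  then have "d \<cdot>\<^sub>v v \<in> vec_line (c \<cdot>\<^sub>v v)" for d
    unfolding vec_line_eq by blast
  moreover have "d \<cdot>\<^sub>v (c \<cdot>\<^sub>v v) \<in> vec_line v" for d
    unfolding vec_line_eq smult_smult_assoc by blast
  ultimately show ?thesis by (fastforce simp: vec_line_eq)
qed

lemma vec_line_eq_iff:
  fixes v w :: "'a::field vec"
  assumes "v \<in> carrier_vec n" "w \<in> carrier_vec n" "w \<noteq> 0\<^sub>v n"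
  shows "vec_line w = vec_line v \<longleftrightarrow> w \<in> vec_line v"
proof
  assume "w \<in> vec_line v"
  then obtain c where c: "w = c \<cdot>\<^sub>v v" by (auto simp: vec_line_eq)
  then have "c \<noteq> 0" using assms by auto
  then show "vec_line w = vec_line v" unfolding c by (rule vec_line_smult)
qed (use mem_vec_line in blast)

lemma card_vec_line:
  fixes v :: "'a::{field,finite} vec"
  assumes v: "v \<in> carrier_vec n" "v \<noteq> 0\<^sub>v n"
  shows "card (vec_line v) = CARD('a)"
proof -
  obtain i where i: "i < n" "v $ i \<noteq> 0"
    using v by (metis carrier_vecD eq_vecI index_zero_vec(1,2))
  have "inj (\<lambda>c. c \<cdot>\<^sub>v v)"
  proof (rule injI)
    fix c d assume "c \<cdot>\<^sub>v v = d \<cdot>\<^sub>v v"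
    then have "(c \<cdot>\<^sub>v v) $ i = (d \<cdot>\<^sub>v v) $ i" by simp
    with i v show "c = d" by simp
  qed
  then show ?thesis unfolding vec_line_eq by (rule card_image)
qed

text \<open>
  Two points share no nonzero vector, so the punctured lines partition the nonzero vectors. The
  product form stays within the natural numbers without a division.
\<close>

lemma card_points_mult:
  "card (points TYPE('a::{field,finite}) n) * (CARD('a) - 1) = CARD('a) ^ n - 1"
proof -
  let ?P = "points TYPE('a) n" and ?punct = "\<lambda>l :: 'a vec set. l - {0\<^sub>v n}"
  have zero: "0\<^sub>v n \<in> l" "finite l" "card l = CARD('a)" "l \<subseteq> carrier_vec n" if "l \<in> ?P" for l
  proof -
    obtain v where v: "l = vec_line v" "v \<in> carrier_vec n" "v \<noteq> 0\<^sub>v n"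
      using \<open>l \<in> ?P\<close> by (auto simp: points_def)
    have "0 \<cdot>\<^sub>v v \<in> l" unfolding v(1) vec_line_eq by blast
    moreover have "0 \<cdot>\<^sub>v v = 0\<^sub>v n" using v(2) by (intro eq_vecI) auto
    ultimately show "0\<^sub>v n \<in> l" by simp
    show "card l = CARD('a)" "finite l" "l \<subseteq> carrier_vec n"
      using v card_vec_line by (auto simp: vec_line_eq)
  qed
  have line: "l = vec_line w" if "l \<in> ?P" "w \<in> l" "w \<noteq> 0\<^sub>v n" for l w
  proof -
    obtain v where v: "l = vec_line v" "v \<in> carrier_vec n"
      using \<open>l \<in> ?P\<close> by (auto simp: points_def)
    moreover have "w \<in> carrier_vec n" using that zero(4) by blast
    ultimately show ?thesis using vec_line_eq_iff[of v n w] that by simp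
  qed
  have "finite ?P" by (simp add: points_def)
  have "carrier_vec n - {0\<^sub>v n} = (\<Union>l \<in> ?P. ?punct l)"
    using mem_vec_line zero(4) by (fastforce simp: points_def)
  then have "card (carrier_vec n - {0\<^sub>v n :: 'a vec}) = card (\<Union>l \<in> ?P. ?punct l)" by simp
  also have "\<dots> = (\<Sum>l \<in> ?P. card (?punct l))"
  proof (rule card_UN_disjoint)
    show "\<forall>l \<in> ?P. \<forall>m \<in> ?P. l \<noteq> m \<longrightarrow> ?punct l \<inter> ?punct m = {}"
      using line by blast
  qed (use zero(2) \<open>finite ?P\<close> in auto)
  also have "\<dots> = (\<Sum>l \<in> ?P. CARD('a) - 1)"
    by (intro sum.cong) (simp_all add: zero)
  finally show ?thesis by (simp add: card_carrier_vec)
qed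


section \<open>Domination in the spectral incidence graph\<close>

text \<open>
  An arc of the graph is given by some generators of its end points. Independence of generators
  (\<open>SIG_adjacent_iff\<close>) moves it back to the matrix with the single eigenline.
\<close>

lemma SIG_pendant:
  assumes "n \<ge> 2" "b \<in> SIG_point_part TYPE('a::field) n"
  shows "\<exists>a \<in> SIG_mat_part TYPE('a) n. \<forall>x. (a, x) \<in> parcs (SIG TYPE('a) n) \<longleftrightarrow> x = b"
proof -
  obtain v :: "'a vec" where b: "b = Inr (vec_line v)" and v: "v \<in> carrier_vec n" "v \<noteq> 0\<^sub>v n"
    using assms(2) by (auto simp: SIG_point_part_def points_def)
  obtain M where M: "M \<in> carrier_mat n n" "M \<noteq> 0\<^sub>m n n" "eigenvector M v 0"
    and single: "\<And>w k. eigenvector M w k \<Longrightarrow> \<exists>c. w = c \<cdot>\<^sub>v v"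
    using exists_mat_with_single_eigenline[OF assms(1) v] by blast
  have ME: "M \<in> eig_mats TYPE('a) n" using M by (auto simp: eig_mats_def)
  have "x = b" if arc: "(Inl (mat_line M), x) \<in> parcs (SIG TYPE('a) n)" for x
  proof -
    obtain N w k where x: "x = Inr (vec_line w)" and N: "N \<in> eig_mats TYPE('a) n" "eigenvector N w k"
      using arc by (auto simp: SIG_def SIG_edges_def)
    then have w: "w \<in> carrier_vec n" "w \<noteq> 0\<^sub>v n" by (auto simp: eig_mats_def eigenvector_def)
    then obtain l where "eigenvector M w l"
      using arc SIG_adjacent_iff[OF ME w] unfolding x by blast
    then have "w \<in> vec_line v" using single unfolding vec_line_eq by blast
    then show "x = b" using vec_line_eq_iff[OF v(1) w] by (simp add: x b)
  qed
  moreover have "(Inl (mat_line M), b) \<in> parcs (SIG TYPE('a) n)"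
    using SIG_adjacent_iff[OF ME v] M(3) b by blast
  moreover have "Inl (mat_line M) \<in> SIG_mat_part TYPE('a) n"
    using ME by (auto simp: SIG_mat_part_def eig_lines_def)
  ultimately show ?thesis by blast
qed

lemma SIG_mat_part_has_neighbour:
  assumes "a \<in> SIG_mat_part TYPE('a::field) n"
  shows "\<exists>b. (a, b) \<in> parcs (SIG TYPE('a) n)"
proof -
  obtain M where a: "a = Inl (mat_line M)" and M: "M \<in> eig_mats TYPE('a) n"
    using assms by (auto simp: SIG_mat_part_def eig_lines_def)
  then obtain v k where "eigenvector M v k" by (auto simp: eig_mats_def)
  then have "(a, Inr (vec_line v)) \<in> parcs (SIG TYPE('a) n)"
    using M unfolding SIG_def SIG_edges_def a by auto
  then show ?thesis ..
qed

lemma SIG_identity_adjacent: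
  assumes "n > 0" "b \<in> SIG_point_part TYPE('a::field) n"
  shows "Inl (mat_line (1\<^sub>m n)) \<in> SIG_mat_part TYPE('a) n"
    and "(b, Inl (mat_line (1\<^sub>m n))) \<in> parcs (SIG TYPE('a) n)"
proof -
  obtain v :: "'a vec" where b: "b = Inr (vec_line v)" and v: "v \<in> carrier_vec n" "v \<noteq> 0\<^sub>v n"
    using assms(2) by (auto simp: SIG_point_part_def points_def)
  have eig: "eigenvector (1\<^sub>m n) v 1" using v by (simp add: eigenvector_def)
  have "1\<^sub>m n \<noteq> (0\<^sub>m n n :: 'a mat)"
  proof
    assume "1\<^sub>m n = (0\<^sub>m n n :: 'a mat)"
    then have "(1\<^sub>m n :: 'a mat) $$ (0, 0) = 0\<^sub>m n n $$ (0, 0)" by simp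
    then show False using \<open>n > 0\<close> by simp
  qed
  then have ME: "(1\<^sub>m n :: 'a mat) \<in> eig_mats TYPE('a) n"
    using eig by (auto simp: eig_mats_def)
  then show "Inl (mat_line (1\<^sub>m n)) \<in> SIG_mat_part TYPE('a) n"
    by (auto simp: SIG_mat_part_def eig_lines_def)
  show "(b, Inl (mat_line (1\<^sub>m n))) \<in> parcs (SIG TYPE('a) n)"
    using ME eig by (auto simp: b SIG_def SIG_edges_def)
qed

theorem theorem1p14:
  fixes n q :: nat
  assumes "n \<ge> 2"
    and "primepow q"
    and "card (UNIV :: 'a::{field,finite} set) = q"
  shows
    "part_domination_number (SIG TYPE('a) n) (SIG_mat_part TYPE('a) n) (SIG_point_part TYPE('a) n)
         = card (points TYPE('a) n)
      \<and> real (card (points TYPE('a) n)) = (real q ^ n - 1) / (real q - 1)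
      \<and> part_domination_number (SIG TYPE('a) n) (SIG_point_part TYPE('a) n) (SIG_mat_part TYPE('a) n)
         = 1
      \<and> real (domination_number (SIG TYPE('a) n)) = (real q ^ n - 1) / (real q - 1)"
proof (intro conjI)
  have "finite (points TYPE('a) n)" by (simp add: points_def)
  then have fin: "finite (SIG_point_part TYPE('a) n)"
    and card: "card (SIG_point_part TYPE('a) n) = card (points TYPE('a) n)"
    by (simp_all add: SIG_point_part_def card_image)
  show "part_domination_number (SIG TYPE('a) n) (SIG_mat_part TYPE('a) n) (SIG_point_part TYPE('a) n)
      = card (points TYPE('a) n)"
    using part_domination_number_if_pendant[OF SIG_bipartite fin SIG_mat_part_has_neighbour
        SIG_pendant[OF \<open>n \<ge> 2\<close>]]
    by (simp add: card)
  have "q > 1" using \<open>primepow q\<close> by (rule primepow_gt_Suc_0[unfolded One_nat_def[symmetric]])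
  have "real (card (points TYPE('a) n) * (q - 1)) = real (q ^ n - 1)"
    using card_points_mult[where 'a='a and n=n] assms(3) by simp
  then have "real (card (points TYPE('a) n)) * (real q - 1) = real q ^ n - 1"
    using \<open>q > 1\<close> by (simp add: of_nat_diff)
  then show number: "real (card (points TYPE('a) n)) = (real q ^ n - 1) / (real q - 1)"
    using \<open>q > 1\<close> by (simp add: field_simps)
  moreover have "real q ^ n > 1" using \<open>q > 1\<close> \<open>n \<ge> 2\<close> by (intro one_less_power) auto
  ultimately have "card (points TYPE('a) n) \<noteq> 0"
    using \<open>q > 1\<close> by (intro notI) simp
  then have "SIG_point_part TYPE('a) n \<noteq> {}" using card by auto
  then show "part_domination_number (SIG TYPE('a) n) (SIG_point_part TYPE('a) n)
      (SIG_mat_part TYPE('a) n) = 1"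
    using SIG_identity_adjacent[where 'a='a and n=n] \<open>n \<ge> 2\<close>
    by (intro part_domination_number_eq_1I) auto
  show "real (domination_number (SIG TYPE('a) n)) = (real q ^ n - 1) / (real q - 1)"
    using domination_number_if_pendant[OF SIG_bipartite fin SIG_mat_part_has_neighbour
        SIG_pendant[OF \<open>n \<ge> 2\<close>]]
    by (simp add: card number)
qed

end
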